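(* For every $\varepsilon > 0$ and every positive integer $d$ there exists a constant $c = c(\varepsilon, d)$ such that for every finite set $A \subseteq \mathbb{R}^d$ with $|A| = n$ points and every integer $p \ge 0$, $$\beta_p\big(\check{C}_1(A), \check{C}_{1+\varepsilon}(A)\big) \le c \cdot n .$$
   Context: For a finite set $A \subseteq \mathbb{R}^d$ and $r \ge 0$, the Čech complex $\check{C}_r(A)$ is the abstract simplicial complex with vertex set $A$ whose simplices are the nonempty subsets $B \subseteq A$ such that the closed balls of radius $r$ centered at the points of $B$ have a non-empty common intersection (equivalently, the smallest enclosing sphere of $B$ has radius at most $r$). Homology is reduced simplicial homology with $\mathbb{Z}/2\mathbb{Z}$ coefficients. For $s \le t$, the persistent Betti number $\beta_p(\check{C}_s, \check{C}_t)$ is the rank of the image of the map $H_p(\check{C}_s) \to H_p(\check{C}_t)$ induced by the inclusion $\check{C}_s \subseteq \check{C}_t$. *)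

theory Defs
  imports
    "HOL-Analysis.Analysis"
    "HOL-Library.Z2"
    "HOL-Library.Poly_Mapping"
    "HOL-Algebra.AbelCoset"
    "Jordan_Normal_Form.VS_Connect"
begin

definition cech_complex :: "real \<Rightarrow> 'a::metric_space set \<Rightarrow> 'a set set" where
  "cech_complex r A = {B. B \<noteq> {} \<and> B \<subseteq> A \<and> (\<Inter>x\<in>B. cball x r) \<noteq> {}}"

text \<open>
  A simplicial complex is given by its set of nonempty simplices.  The empty set is added as the
  only simplex of dimension \<open>-1\<close>, so that the chain complex below is the augmented one and its
  homology is reduced homology.
\<close>

definition simplices :: "'v set set \<Rightarrow> int \<Rightarrow> 'v set set" where
  "simplices K p = {\<sigma>. (\<sigma> \<in> K \<or> \<sigma> = {}) \<and> finite \<sigma> \<and> int (card \<sigma>) = p + 1}"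

type_synonym 'v chain = "'v set \<Rightarrow>\<^sub>0 bit"

text \<open>The fields \<open>mult\<close> and \<open>one\<close> are not used by modules.\<close>

definition chain_space :: "'v set set \<Rightarrow> int \<Rightarrow> (bit, 'v chain) module" where
  "chain_space K p =
     \<lparr>carrier = {c. Poly_Mapping.keys c \<subseteq> simplices K p}, mult = undefined, one = undefined,
      zero = 0, add = (+), smult = (\<lambda>a. Poly_Mapping.map ((*) a))\<rparr>"

text \<open>On vertices this is the augmentation, since \<open>{v} - {v} = {}\<close>.\<close>

definition boundary :: "'v chain \<Rightarrow> 'v chain" where
  "boundary c = (\<Sum>\<sigma>\<in>Poly_Mapping.keys c. \<Sum>v\<in>\<sigma>. 
     Poly_Mapping.single (\<sigma> - {v}) (Poly_Mapping.lookup c \<sigma>))"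

definition cycle_space :: "'v set set \<Rightarrow> int \<Rightarrow> (bit, 'v chain) module" where
  "cycle_space K p =
     (chain_space K p)\<lparr>carrier := {c \<in> carrier (chain_space K p). boundary c = 0}\<rparr>"

definition boundaries :: "'v set set \<Rightarrow> int \<Rightarrow> 'v chain set" where
  "boundaries K p = boundary ` carrier (chain_space K (p + 1))"

text \<open>Adding \<open>N\<close> in the scalar multiplication is needed for the scalar \<open>0\<close>, where the pointwise
  multiple of a coset is \<open>{0}\<close> rather than \<open>N\<close>.\<close>

definition quotient_module :: "('a, 'c, 'm) module_scheme \<Rightarrow> 'c set \<Rightarrow> ('a, 'c set) module" where
  "quotient_module M N =
     \<lparr>carrier = a_rcosets\<^bsub>M\<^esub> N, mult = undefined, one = undefined,
      zero = N, add = set_add M, smult = (\<lambda>a X. N <+>\<^bsub>M\<^esub> ((\<lambda>x. a \<odot>\<^bsub>M\<^esub> x) ` X))\<rparr>"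

definition homology :: "'v set set \<Rightarrow> int \<Rightarrow> (bit, 'v chain set) module" where
  "homology K p = quotient_module (cycle_space K p) (boundaries K p)"

text \<open>
  The map from the homology of a subcomplex to that of \<open>L\<close> induced by the inclusion; it takes the
  coset of a cycle \<open>c\<close> modulo the boundaries of the subcomplex to the coset of \<open>c\<close> modulo the
  boundaries of \<open>L\<close>.
\<close>

definition inclusion_map :: "'v set set \<Rightarrow> int \<Rightarrow> 'v chain set \<Rightarrow> 'v chain set" where
  "inclusion_map L p X = boundaries L p <+>\<^bsub>cycle_space L p\<^esub> X"

definition persistent_betti :: "'v set set \<Rightarrow> 'v set set \<Rightarrow> int \<Rightarrow> nat" where
  "persistent_betti K L p = vectorspace.dim class_ring
     ((homology L p)\<lparr>carrier := inclusion_map L p ` carrier (homology K p)\<rparr>)"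

end

theory Submission
  imports Defs
begin

text \<open>
  Let \<open>N\<close> be a maximal \<open>\<epsilon>\<close>-separated subset of \<open>A\<close>.  Moving each point of \<open>A\<close> to a point of \<open>N\<close> at
  distance less than \<open>\<epsilon>\<close> turns a cycle of the complex of radius \<open>1\<close> into a homologous cycle of the
  complex of radius \<open>1 + \<epsilon>\<close> whose simplices have all their vertices in \<open>N\<close>.  By a packing argument,
  there are only \<open>O(card N)\<close> such simplices, and their number bounds the rank.  The points are moved
  one at a time, so that the chain homotopy is a cone over the star of one vertex.  Over the field
  with two elements, the bound on the rank follows by counting the homology classes in the image.
\<close>

section \<open>Chains with coefficients in the field with two elements\<close>

lemma bit_chain_add_self [simp]: "c + c = (0 :: 'a \<Rightarrow>\<^sub>0 bit)"
  by (rule poly_mapping_eqI) (simp add: lookup_add)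

lemma bit_smult_chain:
  "Poly_Mapping.map ((*) a) c = (if a = (0::bit) then 0 else c)"
  by (rule poly_mapping_eqI, cases a) (auto simp: Poly_Mapping.map.rep_eq when_def)

text \<open>Every nonzero coefficient is \<open>1\<close>, so the sum over the support carries no
  scalars.\<close>

definition linear_extension :: "('a \<Rightarrow> ('b \<Rightarrow>\<^sub>0 bit)) \<Rightarrow> ('a \<Rightarrow>\<^sub>0 bit) \<Rightarrow> ('b \<Rightarrow>\<^sub>0 bit)" where
  "linear_extension f c = (\<Sum>\<sigma>\<in>Poly_Mapping.keys c. f \<sigma>)"

text \<open>Terms may cancel in \<open>c + d\<close>, so additivity is proved by summing over one
  finite set that contains the supports of \<open>c\<close>, \<open>d\<close> and
  \<open>c + d\<close>.\<close>

lemma linear_extension_superset: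
  assumes "finite S" "Poly_Mapping.keys c \<subseteq> S"
  shows "linear_extension f c = (\<Sum>\<sigma>\<in>S. if Poly_Mapping.lookup c \<sigma> = 0 then 0 else f \<sigma>)"
  unfolding linear_extension_def
  by (rule sum.mono_neutral_cong_left) (use assms in \<open>auto simp: in_keys_iff\<close>)

lemma linear_extension_add:
  "linear_extension f (c + d) = linear_extension f c + linear_extension f d"
proof -
  define S where "S = Poly_Mapping.keys c \<union> Poly_Mapping.keys d"
  have S: "finite S" "Poly_Mapping.keys c \<subseteq> S" "Poly_Mapping.keys d \<subseteq> S"
    "Poly_Mapping.keys (c + d) \<subseteq> S"
    using Poly_Mapping.keys_add [of c d] by (auto simp: S_def)
  show ?thesis
    unfolding linear_extension_superset [OF S(1,2)] linear_extension_superset [OF S(1,3)]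
      linear_extension_superset [OF S(1,4)] sum.distrib [symmetric]
    by (rule sum.cong) (auto simp: lookup_add)
qed

lemma linear_extension_0 [simp]: "linear_extension f 0 = 0"
  by (simp add: linear_extension_def)

lemma linear_extension_sum:
  "linear_extension f (\<Sum>i\<in>I. c i) = (\<Sum>i\<in>I. linear_extension f (c i))"
  by (induction I rule: infinite_finite_induct) (simp_all add: linear_extension_add)

lemma linear_extension_single [simp]: "linear_extension f (Poly_Mapping.single \<sigma> 1) = f \<sigma>"
  by (simp add: linear_extension_def)

text \<open>Through this decomposition, additive identities for chains reduce to single
  simplices.\<close>

lemma bit_chain_eq_sum:
  "c = (\<Sum>\<sigma>\<in>Poly_Mapping.keys c. Poly_Mapping.single \<sigma> (1::bit))"
  by (rule poly_mapping_eqI) (auto simp: lookup_sum lookup_single when_def in_keys_iff)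

lemma keys_linear_extensionE:
  assumes "\<tau> \<in> Poly_Mapping.keys (linear_extension f c)"
  obtains \<sigma> where "\<sigma> \<in> Poly_Mapping.keys c" "\<tau> \<in> Poly_Mapping.keys (f \<sigma>)"
  using assms keys_sum [of f "Poly_Mapping.keys c"] unfolding linear_extension_def by blast

section \<open>The boundary operator\<close>

lemma boundary_eq_linear_extension:
  "boundary = linear_extension (\<lambda>\<sigma>. \<Sum>v\<in>\<sigma>. Poly_Mapping.single (\<sigma> - {v}) 1)"
  unfolding boundary_def linear_extension_def fun_eq_iff
  by (intro allI sum.cong refl) (auto simp: in_keys_iff)

lemma boundary_add: "boundary (c + d) = boundary c + boundary d"
  by (simp add: boundary_eq_linear_extension linear_extension_add)

lemma boundary_0 [simp]: "boundary 0 = 0"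
  by (simp add: boundary_eq_linear_extension)

lemma boundary_sum: "boundary (\<Sum>i\<in>I. c i) = (\<Sum>i\<in>I. boundary (c i))"
  by (simp add: boundary_eq_linear_extension linear_extension_sum)

lemma boundary_single:
  "boundary (Poly_Mapping.single \<sigma> 1) = (\<Sum>v\<in>\<sigma>. Poly_Mapping.single (\<sigma> - {v}) 1)"
  by (simp add: boundary_eq_linear_extension)

lemma keys_boundary_subset:
  assumes "\<tau> \<in> Poly_Mapping.keys (boundary c)"
  obtains \<sigma> v where "\<sigma> \<in> Poly_Mapping.keys c" "v \<in> \<sigma>" "\<tau> = \<sigma> - {v}"
proof -
  obtain \<sigma> where \<sigma>: "\<sigma> \<in> Poly_Mapping.keys c"
    "\<tau> \<in> Poly_Mapping.keys (\<Sum>v\<in>\<sigma>. Poly_Mapping.single (\<sigma> - {v}) (1::bit))"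
    using assms unfolding boundary_eq_linear_extension by (rule keys_linear_extensionE)
  then obtain v where "v \<in> \<sigma>" "\<tau> \<in> Poly_Mapping.keys (Poly_Mapping.single (\<sigma> - {v}) (1::bit))"
    using keys_sum [of "\<lambda>v. Poly_Mapping.single (\<sigma> - {v}) (1::bit)" \<sigma>] by blast
  then show thesis
    using \<sigma>(1) that by auto
qed

text \<open>The join with \<open>w\<close>. A simplex that already contains \<open>w\<close> goes to
  \<open>0\<close>, since its join with \<open>w\<close> is degenerate.\<close>

definition vertex_cone :: "'v \<Rightarrow> 'v chain \<Rightarrow> 'v chain" where
  "vertex_cone w = linear_extension (\<lambda>\<sigma>. if w \<in> \<sigma> then 0 else Poly_Mapping.single (insert w \<sigma>) 1)"

lemma vertex_cone_single:
  "vertex_cone w (Poly_Mapping.single \<sigma> 1) = (if w \<in> \<sigma> then 0 else Poly_Mapping.single (insert w \<sigma>) 1)"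
  by (simp add: vertex_cone_def)

lemma vertex_cone_sum: "vertex_cone w (\<Sum>i\<in>I. c i) = (\<Sum>i\<in>I. vertex_cone w (c i))"
  by (simp add: vertex_cone_def linear_extension_sum)

lemma keys_vertex_cone_subset:
  "Poly_Mapping.keys (vertex_cone w c) \<subseteq> insert w ` {\<sigma> \<in> Poly_Mapping.keys c. w \<notin> \<sigma>}"
  unfolding vertex_cone_def by (auto elim!: keys_linear_extensionE split: if_splits)

text \<open>Deleting \<open>w\<close> from the cone returns \<open>\<sigma>\<close>, and deleting
  any other vertex gives the cone over a facet of \<open>\<sigma>\<close>. Augmentation spares a
  correction term for vertices: the facet \<open>{}\<close> of a vertex has the cone
  \<open>{w}\<close>.\<close>

lemma boundary_vertex_cone_single:
  assumes "finite \<sigma>"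
  shows "boundary (vertex_cone w (Poly_Mapping.single \<sigma> 1)) =
    Poly_Mapping.single \<sigma> 1 + vertex_cone w (boundary (Poly_Mapping.single \<sigma> 1))"
proof (cases "w \<in> \<sigma>")
  case True
  \<comment> \<open>Only the facet opposite \<open>w\<close> avoids \<open>w\<close>, and its cone
    is \<open>\<sigma>\<close> again. The right side of the formula thus cancels, in agreement with
    the cone over \<open>\<sigma>\<close> being \<open>0\<close>.\<close>
  have "vertex_cone w (boundary (Poly_Mapping.single \<sigma> 1)) =
      (\<Sum>v\<in>\<sigma>. if v = w then Poly_Mapping.single \<sigma> 1 else 0)"
    unfolding boundary_single vertex_cone_sum
    by (rule sum.cong) (use True in \<open>auto simp: vertex_cone_single insert_absorb\<close>)
  then show ?thesis
    using True assms by (simp add: vertex_cone_single)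
next
  case False
  have "vertex_cone w (boundary (Poly_Mapping.single \<sigma> 1)) =
      (\<Sum>v\<in>\<sigma>. Poly_Mapping.single (insert w \<sigma> - {v}) 1)"
    unfolding boundary_single vertex_cone_sum
  proof (rule sum.cong)
    fix v assume "v \<in> \<sigma>"
    then have "insert w (\<sigma> - {v}) = insert w \<sigma> - {v}"
      using False by auto
    then show "vertex_cone w (Poly_Mapping.single (\<sigma> - {v}) 1) = Poly_Mapping.single (insert w \<sigma> - {v}) 1"
      using False by (simp add: vertex_cone_single)
  qed simp
  then show ?thesis
    using False assms by (simp add: vertex_cone_single boundary_single)
qed

lemma boundary_vertex_cone:
  assumes "\<And>\<sigma>. \<sigma> \<in> Poly_Mapping.keys c \<Longrightarrow> finite \<sigma>"
  shows "boundary (vertex_cone w c) = c + vertex_cone w (boundary c)"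
proof -
  have "boundary (vertex_cone w (\<Sum>\<sigma>\<in>Poly_Mapping.keys c. Poly_Mapping.single \<sigma> 1)) =
      (\<Sum>\<sigma>\<in>Poly_Mapping.keys c. Poly_Mapping.single \<sigma> 1) +
      vertex_cone w (boundary (\<Sum>\<sigma>\<in>Poly_Mapping.keys c. Poly_Mapping.single \<sigma> 1))"
    unfolding boundary_sum vertex_cone_sum sum.distrib [symmetric]
    by (intro sum.cong boundary_vertex_cone_single) (use assms in auto)
  then show ?thesis
    by (simp flip: bit_chain_eq_sum)
qed

text \<open>A simplex is the cone over any of its facets, so the cone formula reduces
  \<open>boundary \<circ> boundary = 0\<close> to a facet.\<close>

lemma boundary_boundary_single:
  assumes "finite \<sigma>"
  shows "boundary (boundary (Poly_Mapping.single \<sigma> 1)) = 0"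
  using assms
proof (induction \<sigma> rule: finite_induct)
  case empty
  then show ?case
    by (simp add: boundary_single)
next
  case (insert w \<sigma>)
  let ?s = "Poly_Mapping.single \<sigma> (1::bit)"
  have fin: "finite \<tau>" if "\<tau> \<in> Poly_Mapping.keys (boundary ?s)" for \<tau>
    using that insert.hyps by (auto elim!: keys_boundary_subset)
  have "Poly_Mapping.single (insert w \<sigma>) 1 = vertex_cone w ?s"
    using insert.hyps by (simp add: vertex_cone_single)
  also have "boundary (boundary \<dots>) = boundary (?s + vertex_cone w (boundary ?s))"
    using insert.hyps by (subst boundary_vertex_cone) auto
  also have "\<dots> = boundary ?s + (boundary ?s + vertex_cone w (boundary (boundary ?s)))"
    using fin by (simp add: boundary_add boundary_vertex_cone)
  also have "\<dots> = 0"
    by (simp add: insert.IH vertex_cone_def)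
  finally show ?case .
qed

lemma boundary_boundary:
  assumes "\<And>\<sigma>. \<sigma> \<in> Poly_Mapping.keys c \<Longrightarrow> finite \<sigma>"
  shows "boundary (boundary c) = 0"
proof -
  have "boundary (boundary (\<Sum>\<sigma>\<in>Poly_Mapping.keys c. Poly_Mapping.single \<sigma> 1)) = 0"
    unfolding boundary_sum by (intro sum.neutral ballI boundary_boundary_single) (rule assms)
  then show ?thesis
    by (simp flip: bit_chain_eq_sum)
qed

section \<open>Pushing cycles off vertices\<close>

lemma carrier_chain_space:
  "c \<in> carrier (chain_space K p) \<longleftrightarrow> Poly_Mapping.keys c \<subseteq> simplices K p"
  by (simp add: chain_space_def)

lemma carrier_chain_space_mono:
  assumes "K \<subseteq> L"
  shows "carrier (chain_space K p) \<subseteq> carrier (chain_space L p)"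
  using assms unfolding chain_space_def simplices_def by (simp, blast)

lemma carrier_cycle_space:
  "c \<in> carrier (cycle_space K p) \<longleftrightarrow> c \<in> carrier (chain_space K p) \<and> boundary c = 0"
  by (simp add: cycle_space_def)

lemma carrier_chain_space_add:
  assumes "c \<in> carrier (chain_space K p)" "d \<in> carrier (chain_space K p)"
  shows "c + d \<in> carrier (chain_space K p)"
  using assms Poly_Mapping.keys_add [of c d] by (auto simp: carrier_chain_space)

lemma boundary_in_chain_space:
  assumes closed: "\<forall>\<sigma>\<in>M. \<forall>\<tau>\<subseteq>\<sigma>. \<tau> \<noteq> {} \<longrightarrow> \<tau> \<in> M"
    and "c \<in> carrier (chain_space M (p + 1))"
  shows "boundary c \<in> carrier (chain_space M p)"
proof -
  have "\<tau> \<in> simplices M p" if \<tau>: "\<tau> \<in> Poly_Mapping.keys (boundary c)" for \<tau>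
  proof -
    obtain \<sigma> v where \<sigma>: "\<sigma> \<in> Poly_Mapping.keys c" "v \<in> \<sigma>" "\<tau> = \<sigma> - {v}"
      using keys_boundary_subset [OF \<tau>] .
    then have "\<sigma> \<in> simplices M (p + 1)"
      using assms(2) by (auto simp: carrier_chain_space)
    then have fin: "finite \<sigma>" and card: "int (card \<sigma>) = p + 2"
      and "\<sigma> \<in> M"
      using \<sigma>(2) by (auto simp: simplices_def)
    have "card \<sigma> = Suc (card \<tau>)"
      unfolding \<sigma>(3) by (rule card.remove [OF fin \<sigma>(2)])
    then have "int (card \<tau>) = p + 1"
      using card by simp
    moreover have "\<tau> \<subseteq> \<sigma>"
      unfolding \<sigma>(3) by blast
    \<comment> \<open>The facet of a vertex is empty; \<open>closed\<close> does not cover it, but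
      \<open>simplices\<close> admits it.\<close>
    then have "\<tau> \<in> M \<or> \<tau> = {}"
      using closed [rule_format, OF \<open>\<sigma> \<in> M\<close>] by auto
    ultimately show ?thesis
      using fin \<sigma>(3) by (auto simp: simplices_def)
  qed
  then show ?thesis
    by (auto simp: carrier_chain_space)
qed

text \<open>A push stays among the cycles of the same complex, so pushes can be iterated.\<close>

lemma cycle_add_boundary:
  assumes closed: "\<forall>\<sigma>\<in>M. \<forall>\<tau>\<subseteq>\<sigma>. \<tau> \<noteq> {} \<longrightarrow> \<tau> \<in> M"
    and z: "z \<in> carrier (cycle_space M p)" and y: "y \<in> carrier (chain_space M (p + 1))"
  shows "z + boundary y \<in> carrier (cycle_space M p)"
proof -
  have "boundary (boundary y) = 0"
    using y by (intro boundary_boundary) (auto simp: carrier_chain_space simplices_def)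
  then show ?thesis
    using z boundary_in_chain_space [OF closed y]
    by (simp add: carrier_cycle_space boundary_add carrier_chain_space_add)
qed

text \<open>With \<open>R\<close> the part of the cycle \<open>z\<close> supported on the simplices containing \<open>v\<close>, the cone formula
  gives \<open>z + boundary (vertex_cone w R) = (z + R) + vertex_cone w (boundary R)\<close>; here \<open>z + R\<close>
  avoids \<open>v\<close>, and so does \<open>boundary R = boundary (z + R)\<close>.\<close>

lemma push_cycle_off_vertex:
  assumes M: "\<forall>\<sigma>\<in>M. v \<in> \<sigma> \<longrightarrow> insert w \<sigma> \<in> M" and vw: "v \<noteq> w"
    and z: "z \<in> carrier (cycle_space M p)"
  obtains y where "y \<in> carrier (chain_space M (p + 1))"
    "\<forall>\<sigma>\<in>Poly_Mapping.keys (z + boundary y).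
       v \<notin> \<sigma> \<and> (\<exists>\<tau>\<in>Poly_Mapping.keys z. \<sigma> \<subseteq> insert w \<tau>)"
proof
  define R where
    "R = linear_extension (\<lambda>\<sigma>. if v \<in> \<sigma> then Poly_Mapping.single \<sigma> 1 else 0) z"
  define Q where
    "Q = linear_extension (\<lambda>\<sigma>. if v \<in> \<sigma> then 0 else Poly_Mapping.single \<sigma> 1) z"
  have kR: "v \<in> \<sigma> \<and> \<sigma> \<in> Poly_Mapping.keys z" if "\<sigma> \<in> Poly_Mapping.keys R" for \<sigma>
    using that unfolding R_def by (auto elim!: keys_linear_extensionE split: if_splits)
  have kQ: "v \<notin> \<sigma> \<and> \<sigma> \<in> Poly_Mapping.keys z" if "\<sigma> \<in> Poly_Mapping.keys Q" for \<sigma>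
    using that unfolding Q_def by (auto elim!: keys_linear_extensionE split: if_splits)
  have "z = R + Q"
  proof -
    have "R + Q = (\<Sum>\<sigma>\<in>Poly_Mapping.keys z. Poly_Mapping.single \<sigma> 1)"
      unfolding R_def Q_def linear_extension_def sum.distrib [symmetric]
      by (rule sum.cong) auto
    then show ?thesis
      by (simp flip: bit_chain_eq_sum)
  qed
  then have Q: "Q = z + R"
    by (simp add: add.commute)
  have zk: "\<sigma> \<in> simplices M p" if "\<sigma> \<in> Poly_Mapping.keys z" for \<sigma>
    using that z by (auto simp: carrier_cycle_space carrier_chain_space)
  have "boundary R = boundary Q"
    using z by (simp add: Q boundary_add carrier_cycle_space)
  moreover have "boundary (vertex_cone w R) = R + vertex_cone w (boundary R)"
    using kR zk by (intro boundary_vertex_cone) (auto simp: simplices_def)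
  ultimately have eq: "z + boundary (vertex_cone w R) = Q + vertex_cone w (boundary Q)"
    by (simp add: Q add.assoc)
  \<comment> \<open>Each simplex of \<open>R\<close> contains \<open>v\<close>, so inserting
    \<open>w\<close> stays in \<open>M\<close>. Simplices containing \<open>w\<close> vanish in the
    cone, and the others gain exactly one dimension.\<close>
  show "vertex_cone w R \<in> carrier (chain_space M (p + 1))"
  proof -
    have "insert w \<sigma> \<in> simplices M (p + 1)" if "\<sigma> \<in> Poly_Mapping.keys R" "w \<notin> \<sigma>" for \<sigma>
      using kR [OF that(1)] zk [of \<sigma>] that(2) M by (auto simp: simplices_def)
    then show ?thesis
      using keys_vertex_cone_subset [of w R] by (auto simp: carrier_chain_space)
  qed
  show "\<forall>\<sigma>\<in>Poly_Mapping.keys (z + boundary (vertex_cone w R)).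
      v \<notin> \<sigma> \<and> (\<exists>\<tau>\<in>Poly_Mapping.keys z. \<sigma> \<subseteq> insert w \<tau>)"
  proof
    fix \<sigma> assume \<sigma>: "\<sigma> \<in> Poly_Mapping.keys (z + boundary (vertex_cone w R))"
    have "\<sigma> \<in> Poly_Mapping.keys Q \<union> Poly_Mapping.keys (vertex_cone w (boundary Q))"
      using subsetD [OF Poly_Mapping.keys_add \<sigma> [unfolded eq]] .
    then show "v \<notin> \<sigma> \<and> (\<exists>\<tau>\<in>Poly_Mapping.keys z. \<sigma> \<subseteq> insert w \<tau>)"
    proof
      assume "\<sigma> \<in> Poly_Mapping.keys Q"
      then show ?thesis using kQ by blast
    next
      assume "\<sigma> \<in> Poly_Mapping.keys (vertex_cone w (boundary Q))"
      then have "\<sigma> \<in> insert w ` {\<rho> \<in> Poly_Mapping.keys (boundary Q). w \<notin> \<rho>}"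
        by (rule subsetD [OF keys_vertex_cone_subset])
      then obtain \<rho> where \<rho>: "\<rho> \<in> Poly_Mapping.keys (boundary Q)" "\<sigma> = insert w \<rho>"
        by blast
      \<comment> \<open>Faces of simplices of \<open>Q\<close> still avoid \<open>v\<close>, and
        coning adds only \<open>w\<close>, which differs from \<open>v\<close>.\<close>
      obtain \<tau> u where "\<tau> \<in> Poly_Mapping.keys Q" "\<rho> = \<tau> - {u}"
        using keys_boundary_subset [OF \<rho>(1)] .
      then have "v \<notin> \<sigma>" "\<sigma> \<subseteq> insert w \<tau>" "\<tau> \<in> Poly_Mapping.keys z"
        using kQ [of \<tau>] vw \<rho>(2) by auto
      then show ?thesis
        by blast
    qed
  qed
qed

text \<open>The vertices are removed one at a time and the correcting chains are added up. As
  \<open>\<phi>\<close> takes \<open>V\<close> outside \<open>V\<close>, a push never brings back a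
  vertex removed before.\<close>

lemma push_cycle_off_vertices:
  assumes closed: "\<forall>\<sigma>\<in>M. \<forall>\<tau>\<subseteq>\<sigma>. \<tau> \<noteq> {} \<longrightarrow> \<tau> \<in> M"
    and \<phi>: "\<forall>v\<in>V. \<phi> v \<notin> V \<and> (\<forall>\<sigma>\<in>M. v \<in> \<sigma> \<longrightarrow> insert (\<phi> v) \<sigma> \<in> M)"
    and z: "z \<in> carrier (cycle_space M p)" and "finite V"
  obtains y where "y \<in> carrier (chain_space M (p + 1))"
    "\<forall>\<sigma>\<in>Poly_Mapping.keys (z + boundary y). \<sigma> \<inter> V = {}"
proof -
  have "\<exists>y\<in>carrier (chain_space M (p + 1)).
      \<forall>\<sigma>\<in>Poly_Mapping.keys (z + boundary y). \<sigma> \<inter> W = {}" if "W \<subseteq> V" for W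
    using finite_subset [OF that \<open>finite V\<close>] that
  proof (induction W rule: finite_induct)
    case empty
    show ?case
      by (rule bexI [of _ 0]) (auto simp: carrier_chain_space)
  next
    case (insert v W)
    then obtain y where y: "y \<in> carrier (chain_space M (p + 1))"
      "\<forall>\<sigma>\<in>Poly_Mapping.keys (z + boundary y). \<sigma> \<inter> W = {}"
      by auto
    have v: "v \<noteq> \<phi> v" "\<phi> v \<notin> W" "\<forall>\<sigma>\<in>M. v \<in> \<sigma> \<longrightarrow> insert (\<phi> v) \<sigma> \<in> M"
      using insert.prems \<phi> by auto
    obtain x where x: "x \<in> carrier (chain_space M (p + 1))"
      "\<forall>\<sigma>\<in>Poly_Mapping.keys (z + boundary y + boundary x).
        v \<notin> \<sigma> \<and> (\<exists>\<tau>\<in>Poly_Mapping.keys (z + boundary y). \<sigma> \<subseteq> insert (\<phi> v) \<tau>)"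
      using push_cycle_off_vertex [OF v(3,1) cycle_add_boundary [OF closed z y(1)]] .
    have "\<sigma> \<inter> insert v W = {}" if "\<sigma> \<in> Poly_Mapping.keys (z + boundary (y + x))" for \<sigma>
    proof -
      have "v \<notin> \<sigma> \<and> (\<exists>\<tau>\<in>Poly_Mapping.keys (z + boundary y). \<sigma> \<subseteq> insert (\<phi> v) \<tau>)"
        using x(2) that by (simp add: boundary_add add.assoc)
      then show ?thesis
        using y(2) v(2) by blast
    qed
    then show ?case
      by (intro bexI [OF _ carrier_chain_space_add [OF y(1) x(1)]] ballI)
  qed
  from this [OF subset_refl] show thesis
    by (elim bexE) (rule that)
qed

section \<open>Bounding persistent Betti numbers\<close>

text \<open>A chain is determined by its support, so these chains inject into
  \<open>Pow S\<close>.\<close>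

lemma card_bit_chains:
  assumes "finite S"
  shows "finite {c :: 'a \<Rightarrow>\<^sub>0 bit. Poly_Mapping.keys c \<subseteq> S}"
    and "card {c :: 'a \<Rightarrow>\<^sub>0 bit. Poly_Mapping.keys c \<subseteq> S} \<le> 2 ^ card S"
proof -
  let ?C = "{c :: 'a \<Rightarrow>\<^sub>0 bit. Poly_Mapping.keys c \<subseteq> S}"
  have inj: "inj_on Poly_Mapping.keys ?C"
  proof (rule inj_onI)
    fix c d :: "'a \<Rightarrow>\<^sub>0 bit" assume "Poly_Mapping.keys c = Poly_Mapping.keys d"
    then show "c = d"
      using bit_chain_eq_sum [of c] bit_chain_eq_sum [of d] by simp
  qed
  have sub: "Poly_Mapping.keys ` ?C \<subseteq> Pow S"
    by auto
  show "finite ?C"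
    using inj_on_finite [OF inj sub] assms by simp
  show "card ?C \<le> 2 ^ card S"
    using card_inj_on_le [OF inj sub] assms by (simp add: card_Pow)
qed

section \<open>Dimension of a finite vector space over the field with two elements\<close>

lemma UNIV_bit: "(UNIV :: bit set) = {0, 1}"
  by (metis (full_types) UNIV_eq_I bit.exhaust insertCI)

text \<open>Distinct coefficient functions on a basis \<open>B\<close> give distinct vectors, so the
  space has at least \<open>2 ^ card B\<close> elements.\<close>

lemma bit_vectorspace_dim_le:
  assumes vs: "vectorspace (class_ring :: bit ring) V"
    and finV: "finite (carrier V)" and le: "card (carrier V) \<le> 2 ^ n"
  shows "vectorspace.dim (class_ring :: bit ring) V \<le> n"
proof -
  interpret vectorspace "class_ring :: bit ring" V by (rule vs)
  \<comment> \<open>The carrier is itself a finite spanning set, which yields a finite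
    basis.\<close>
  have "span (carrier V) = carrier V"
    by (intro subset_antisym span_is_subset2 in_own_span subset_refl)
  then have fd: "fin_dim"
    unfolding fin_dim_def using finV by (intro exI [of _ "carrier V"]) simp
  then obtain B where B: "finite B" "basis B"
    using finite_basis_exists by blast
  then have BV: "B \<subseteq> carrier V"
    unfolding basis_def by blast
  \<comment> \<open>Extensional functions have a fixed value outside \<open>B\<close>, so the
    coefficients of a vector are unique and there are finitely many choices.\<close>
  let ?F = "B \<rightarrow>\<^sub>E (UNIV :: bit set)"
  have lin: "lincomb a B \<in> carrier V" if "a \<in> ?F" for a
    using BV by (intro lincomb_closed) auto
  have "inj_on (\<lambda>a. lincomb a B) ?F"
  proof (rule inj_onI)
    fix a b assume ab: "a \<in> ?F" "b \<in> ?F" "lincomb a B = lincomb b B"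
    then show "a = b"
      using basis_criterion [OF B(1) BV] B(2) lin [OF ab(1)] by auto
  qed
  then have "card ?F \<le> card (carrier V)"
    using lin finV by (intro card_inj_on_le) auto
  moreover have "card ?F = 2 ^ card B"
    using B(1) by (simp add: card_PiE UNIV_bit numeral_2_eq_2)
  ultimately have "(2::nat) ^ card B \<le> 2 ^ n"
    using le by linarith
  then have "card B \<le> n"
    by simp
  then show ?thesis
    using dim_basis B by simp
qed

text \<open>By \<open>rep\<close>, every class in the image has a representative supported on
  \<open>S\<close>. There are at most \<open>2 ^ card S\<close> such chains, hence at most that many
  classes, and this bounds the dimension.\<close>

lemma persistent_betti_le_card:
  assumes KL: "K \<subseteq> L" and S: "finite S"
    and rep: "\<forall>z\<in>carrier (cycle_space K p).
      \<exists>y\<in>carrier (chain_space L (p + 1)). Poly_Mapping.keys (z + boundary y) \<subseteq> S"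
  shows "persistent_betti K L p \<le> card S"
proof -
  define B where "B = boundaries L p"
  define Z where "Z = carrier (cycle_space K p)"
  \<comment> \<open>The coset of \<open>z\<close> modulo the boundaries of \<open>L\<close>. With
    every class written as some \<open>q z\<close>, the operations on cosets turn into operations on
    chains.\<close>
  define q where "q z = (\<lambda>b. b + z) ` B" for z
  define W where
    "W = (homology L p)\<lparr>carrier := inclusion_map L p ` carrier (homology K p)\<rparr>"
  have B0: "0 \<in> B"
    unfolding B_def boundaries_def by (rule image_eqI [of _ _ 0]) (auto simp: carrier_chain_space)
  have B_add: "a + b \<in> B" if "a \<in> B" "b \<in> B" for a b
    using that unfolding B_def boundaries_def
    by (auto simp flip: boundary_add intro!: imageI carrier_chain_space_add)
  have BK: "boundaries K p \<subseteq> B"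
    unfolding B_def boundaries_def
    by (intro image_mono carrier_chain_space_mono KL)
  have BK0: "0 \<in> boundaries K p"
    unfolding boundaries_def by (rule image_eqI [of _ _ 0]) (auto simp: carrier_chain_space)
  have Z0: "0 \<in> Z"
    by (simp add: Z_def carrier_cycle_space carrier_chain_space)
  have Z_add: "a + b \<in> Z" if "a \<in> Z" "b \<in> Z" for a b
    using that by (simp add: Z_def carrier_cycle_space carrier_chain_space_add boundary_add)
  have q_eq: "q x = q z" if "b \<in> B" "x = b + z" for b x z
  proof -
    have "(\<lambda>a. a + x) ` B \<subseteq> (\<lambda>a. a + z) ` B" if "b \<in> B" "x = b + z" for b x z
    proof
      fix t assume "t \<in> (\<lambda>a. a + x) ` B"
      then obtain a where "a \<in> B" "t = (a + b) + z"
        using \<open>x = b + z\<close> by (auto simp: add.assoc)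
      then show "t \<in> (\<lambda>a. a + z) ` B"
        using B_add \<open>b \<in> B\<close> by blast
    qed
    \<comment> \<open>In characteristic two \<open>x = b + z\<close> also reads
      \<open>z = b + x\<close>, so the inclusion holds with \<open>x\<close> and \<open>z\<close>
      exchanged.\<close>
    from this [OF that] this [OF \<open>b \<in> B\<close>, of z x] show ?thesis
      unfolding q_def using that(2) by auto
  qed
  have q_add: "set_add (cycle_space L p) (q x) (q z) = q (x + z)" for x z
  proof -
    have "a + x + (b + z) \<in> (\<lambda>b. b + (x + z)) ` B" if "a \<in> B" "b \<in> B" for a b
      using B_add [OF that] by (intro image_eqI [of _ _ "a + b"]) (simp_all add: ac_simps)
    moreover have "\<exists>a\<in>B. \<exists>c\<in>B. b + (x + z) = a + x + (c + z)" if "b \<in> B" for b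
      using that B0 by (intro bexI [of _ b] bexI [of _ 0]) (simp_all add: ac_simps)
    ultimately show ?thesis
      by (auto simp: set_add_def set_mult_def q_def cycle_space_def chain_space_def)
  qed
  have B_q: "B = q 0"
    by (simp add: q_def)
  have carrier_W: "carrier W = q ` Z"
  proof -
    \<comment> \<open>Boundaries of \<open>K\<close> are absorbed by \<open>B\<close>, so enlarging
      a coset of \<open>boundaries K p\<close> by \<open>B\<close> gives the coset of the same cycle
      modulo \<open>B\<close>.\<close>
    have "inclusion_map L p (a_r_coset (cycle_space K p) (boundaries K p) z) = q z" for z
    proof -
      have "b + (k + z) \<in> (\<lambda>b. b + z) ` B" if "b \<in> B" "k \<in> boundaries K p" for b k
        using B_add [of b k] that BK by (intro image_eqI [of _ _ "b + k"]) (auto simp: ac_simps)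
      moreover have "\<exists>b'\<in>B. \<exists>k\<in>boundaries K p. b + z = b' + (k + z)" if "b \<in> B" for b
        using that BK0 by (intro bexI [of _ b] bexI [of _ 0]) simp_all
      ultimately show ?thesis
        unfolding inclusion_map_def B_def [symmetric]
        by (auto simp: a_r_coset_def r_coset_def set_add_def set_mult_def q_def cycle_space_def
            chain_space_def)
    qed
    then show ?thesis
      by (auto simp: W_def homology_def quotient_module_def A_RCOSETS_def RCOSETS_def Z_def
          a_r_coset_def image_iff)
  qed
  have zero_W: "zero W = q 0"
    by (simp add: W_def homology_def quotient_module_def B_q B_def [symmetric])
  have add_W: "add W (q x) (q z) = q (x + z)" for x z
    using q_add by (simp add: W_def homology_def quotient_module_def)
  have smult_W: "smult W a (q x) = q (if a = 0 then 0 else x)" for a x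
  proof -
    have "smult (cycle_space L p) a = (\<lambda>c. if a = 0 then 0 else c)"
      by (simp add: cycle_space_def chain_space_def bit_smult_chain fun_eq_iff
          del: mult_bit_eq_and)
    then have "smult (cycle_space L p) a ` q x = (if a = 0 then {0} else q x)"
      using B0 by (auto simp: q_def)
    moreover have "set_add (cycle_space L p) (q 0) {0} = q 0"
      by (auto simp: set_add_def set_mult_def q_def cycle_space_def chain_space_def)
    ultimately show ?thesis
      by (auto simp: W_def homology_def quotient_module_def q_add B_q B_def [symmetric])
  qed
  \<comment> \<open>The axioms transfer along \<open>q\<close> from the cycles in \<open>Z\<close>.
    Both \<open>1 + 1 = 0\<close> in the scalars and the existence of negatives come down to
    \<open>z + z = 0\<close>.\<close>
  have vs: "vectorspace (class_ring :: bit ring) W"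
  proof (rule vs_criteria [OF class_field])
    show "\<forall>a b v. a \<in> carrier class_ring \<and> b \<in> carrier class_ring \<and> v \<in> carrier W \<longrightarrow>
        smult W (a \<oplus>\<^bsub>class_ring\<^esub> b) v = add W (smult W a v) (smult W b v)"
    proof (intro allI impI)
      fix a b :: bit and v
      assume "a \<in> carrier class_ring \<and> b \<in> carrier class_ring \<and> v \<in> carrier W"
      then show "smult W (a \<oplus>\<^bsub>class_ring\<^esub> b) v = add W (smult W a v) (smult W b v)"
        by (cases a; cases b) (auto simp: carrier_W smult_W add_W)
    qed
    show "\<forall>v\<in>carrier W. \<exists>w\<in>carrier W. add W v w = zero W"
    proof
      fix v assume v: "v \<in> carrier W"
      then have "add W v v = zero W"
        by (auto simp: carrier_W add_W zero_W)
      then show "\<exists>w\<in>carrier W. add W v w = zero W"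
        using v by blast
    qed
  qed (use Z0 Z_add in \<open>auto simp: carrier_W zero_W add_W smult_W ac_simps\<close>)
  have sub: "carrier W \<subseteq> q ` {c. Poly_Mapping.keys c \<subseteq> S}"
  proof -
    have "q z \<in> q ` {c. Poly_Mapping.keys c \<subseteq> S}" if z: "z \<in> Z" for z
    proof -
      obtain y where y: "y \<in> carrier (chain_space L (p + 1))"
        "Poly_Mapping.keys (z + boundary y) \<subseteq> S"
        using bspec [OF rep z [unfolded Z_def]] by (elim bexE)
      have "boundary y \<in> B"
        unfolding B_def boundaries_def using y(1) by (rule imageI)
      then have "q (z + boundary y) = q z"
        by (rule q_eq) (rule add.commute)
      then have "q z = q (z + boundary y)"
        by (rule sym)
      then show ?thesis
        by (rule image_eqI) (use y(2) in simp)
    qed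
    then show ?thesis
      by (auto simp: carrier_W)
  qed
  have fin: "finite (q ` {c. Poly_Mapping.keys c \<subseteq> S})"
    using card_bit_chains [OF S] by blast
  have "card (carrier W) \<le> card (q ` {c. Poly_Mapping.keys c \<subseteq> S})"
    using card_mono [OF fin sub] .
  also have "\<dots> \<le> 2 ^ card S"
    by (rule order_trans [OF card_image_le [OF card_bit_chains(1) [OF S]] card_bit_chains(2) [OF S]])
  finally show ?thesis
    unfolding persistent_betti_def W_def [symmetric]
    using bit_vectorspace_dim_le [OF vs finite_subset [OF sub fin]] by simp
qed

section \<open>Separated sets\<close>

text \<open>The net is built greedily: a new point joins it only if no point chosen before is closer
  than \<open>\<epsilon>\<close>.\<close>

lemma separated_net_exists:
  fixes A :: "'a::metric_space set"
  assumes "finite A" "\<epsilon> > 0"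
  obtains N where "N \<subseteq> A" "pairwise (\<lambda>a b. \<epsilon> \<le> dist a b) N"
    "\<forall>a\<in>A. \<exists>b\<in>N. dist a b < \<epsilon>"
proof -
  have "\<exists>N\<subseteq>A. pairwise (\<lambda>a b. \<epsilon> \<le> dist a b) N \<and> (\<forall>a\<in>A. \<exists>b\<in>N. dist a b < \<epsilon>)"
    using assms(1)
  proof (induction A rule: finite_induct)
    case empty
    then show ?case by auto
  next
    case (insert x A)
    then obtain N where N: "N \<subseteq> A" "pairwise (\<lambda>a b. \<epsilon> \<le> dist a b) N"
      "\<forall>a\<in>A. \<exists>b\<in>N. dist a b < \<epsilon>"
      by auto
    show ?case
    proof (cases "\<exists>b\<in>N. dist x b < \<epsilon>")
      case True
      then show ?thesis
        using N by (intro exI [of _ N] conjI subset_insertI2) simp_all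
    next
      case False
      show ?thesis
      proof (intro exI [of _ "insert x N"] conjI)
        show "insert x N \<subseteq> insert x A"
          using N(1) by blast
        show "pairwise (\<lambda>a b. \<epsilon> \<le> dist a b) (insert x N)"
          using N(2) False by (simp add: pairwise_insert dist_commute not_less)
        have "dist x x < \<epsilon>"
          using \<open>\<epsilon> > 0\<close> by simp
        then show "\<forall>a\<in>insert x A. \<exists>b\<in>insert x N. dist a b < \<epsilon>"
          using N(3) by blast
      qed
    qed
  qed
  then show thesis
    using that by blast
qed

text \<open>Cover the ball around the origin by finitely many balls of radius
  \<open>\<epsilon> / 2\<close> and translate by \<open>x\<close>. Two points of \<open>N\<close> in
  the same small ball would be closer than \<open>\<epsilon>\<close>, so the number of small balls
  is a bound, uniform in \<open>N\<close> and \<open>x\<close>.\<close>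

lemma separated_set_ball_card_bounded:
  assumes "\<epsilon> > 0"
  shows "\<exists>m. \<forall>(N :: 'a::euclidean_space set) x. finite N \<longrightarrow>
    pairwise (\<lambda>a b. \<epsilon> \<le> dist a b) N \<longrightarrow> card (N \<inter> cball x r) \<le> m"
proof -
  obtain T where T: "finite T" "cball (0::'a) r \<subseteq> (\<Union>t\<in>T. ball t (\<epsilon> / 2))"
    using seq_compact_imp_totally_bounded [OF compact_imp_seq_compact [OF compact_cball], of 0 r]
      half_gt_zero [OF assms] by blast
  have "card (N \<inter> cball x r) \<le> card T"
    if N: "finite N" "pairwise (\<lambda>a b. \<epsilon> \<le> dist a b) N" for N and x :: 'a
  proof -
    have "\<exists>t\<in>T. dist t (a - x) < \<epsilon> / 2" if "a \<in> N \<inter> cball x r" for a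
    proof -
      have "a - x \<in> cball 0 r"
        using that by (simp add: dist_norm norm_minus_commute)
      then obtain t where "t \<in> T" "a - x \<in> ball t (\<epsilon> / 2)"
        using T(2) by blast
      then show ?thesis
        by auto
    qed
    then obtain f where f: "\<And>a. a \<in> N \<inter> cball x r \<Longrightarrow> f a \<in> T \<and> dist (f a) (a - x) < \<epsilon> / 2"
      by metis
    have "inj_on f (N \<inter> cball x r)"
    proof (rule inj_onI, rule ccontr)
      fix a b assume ab: "a \<in> N \<inter> cball x r" "b \<in> N \<inter> cball x r" "f a = f b" "a \<noteq> b"
      have "dist a b = dist (a - x) (b - x)"
        by (simp add: dist_norm)
      also have "\<dots> < \<epsilon>"
        using f [OF ab(1)] f [OF ab(2)] ab(3) dist_triangle_half_r [of "f a" "a - x" \<epsilon> "b - x"]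
        by (simp add: dist_commute)
      finally show False
        using pairwiseD [OF N(2), of a b] ab by simp
    qed
    then show ?thesis
      using f T(1) by (intro card_inj_on_le) auto
  qed
  then show ?thesis
    by blast
qed

text \<open>Any vertex \<open>v\<close> of such a \<open>\<tau>\<close> places it among the at most
  \<open>2 ^ m\<close> subsets of \<open>N \<inter> cball v r\<close>.\<close>

lemma card_bounded_diameter_subsets_le:
  fixes N :: "'a::metric_space set"
  assumes "finite N" and m: "\<And>x. card (N \<inter> cball x r) \<le> m"
  shows "card {\<tau>. \<tau> \<noteq> {} \<and> \<tau> \<subseteq> N \<and> (\<forall>a\<in>\<tau>. \<forall>b\<in>\<tau>. dist a b \<le> r)} \<le> card N * 2 ^ m"
    (is "card ?S \<le> _")
proof -
  have "?S \<subseteq> (\<Union>v\<in>N. Pow (N \<inter> cball v r))"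
  proof
    fix \<tau> assume \<tau>: "\<tau> \<in> ?S"
    then obtain v where "v \<in> \<tau>"
      by blast
    then have "v \<in> N" "\<tau> \<in> Pow (N \<inter> cball v r)"
      using \<tau> by auto
    then show "\<tau> \<in> (\<Union>v\<in>N. Pow (N \<inter> cball v r))"
      by blast
  qed
  then have "card ?S \<le> card (\<Union>v\<in>N. Pow (N \<inter> cball v r))"
    using assms(1) by (intro card_mono) auto
  also have "\<dots> \<le> (\<Sum>v\<in>N. card (Pow (N \<inter> cball v r)))"
    by (rule card_UN_le [OF assms(1)])
  also have "\<dots> \<le> (\<Sum>v\<in>N. 2 ^ m)"
    using assms by (intro sum_mono) (simp add: card_Pow del: Pow_Int_eq)
  finally show ?thesis
    by simp
qed

section \<open>The linear bound\<close>

text \<open>All pushes take place in one fixed complex \<open>M\<close> between the two Cech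
  complexes. A pushed cycle has its vertices in \<open>N\<close>, and two vertices of a simplex,
  both within \<open>1 + \<epsilon>\<close> of a common point, are at most
  \<open>2 * (1 + \<epsilon>)\<close> apart.\<close>

lemma persistent_betti_cech_le:
  fixes A N :: "'a::metric_space set"
  assumes "finite A" "N \<subseteq> A" "\<epsilon> > 0" "p \<ge> 0"
    and net: "\<forall>a\<in>A. \<exists>b\<in>N. dist a b < \<epsilon>"
  shows "persistent_betti (cech_complex 1 A) (cech_complex (1 + \<epsilon>) A) p \<le>
    card {\<tau>. \<tau> \<noteq> {} \<and> \<tau> \<subseteq> N \<and> (\<forall>a\<in>\<tau>. \<forall>b\<in>\<tau>. dist a b \<le> 2 * (1 + \<epsilon>))}"
    (is "_ \<le> card ?S")
proof (rule persistent_betti_le_card)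
  \<comment> \<open>Points of the net may be as far as \<open>1 + \<epsilon>\<close> from the common point, so that adjoining to a
    simplex the net points near its vertices does not leave this complex.\<close>
  define M where "M = {\<tau>. \<tau> \<noteq> {} \<and> \<tau> \<subseteq> A \<and>
    (\<exists>y. \<forall>a\<in>\<tau>. dist a y \<le> 1 + \<epsilon> \<and> (a \<notin> N \<longrightarrow> dist a y \<le> 1))}"
  obtain \<phi> where \<phi>: "\<forall>a\<in>A. \<phi> a \<in> N \<and> dist a (\<phi> a) < \<epsilon>"
    using bchoice [OF net [unfolded Bex_def]] by (elim exE)
  have KM: "cech_complex 1 A \<subseteq> M"
  proof
    fix \<tau> assume "\<tau> \<in> cech_complex 1 A"
    then obtain y where y: "\<tau> \<noteq> {}" "\<tau> \<subseteq> A" "\<forall>a\<in>\<tau>. dist a y \<le> 1"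
      by (auto simp: cech_complex_def)
    have "dist a y \<le> 1 + \<epsilon>" if "a \<in> \<tau>" for a
      using y(3) that \<open>\<epsilon> > 0\<close> by (simp add: add_increasing2)
    then show "\<tau> \<in> M"
      using y unfolding M_def by blast
  qed
  have MC: "M \<subseteq> cech_complex (1 + \<epsilon>) A"
  proof
    fix \<tau> assume "\<tau> \<in> M"
    then obtain y where y: "\<tau> \<noteq> {}" "\<tau> \<subseteq> A" "\<forall>a\<in>\<tau>. dist a y \<le> 1 + \<epsilon>"
      by (auto simp: M_def)
    then have "y \<in> (\<Inter>a\<in>\<tau>. cball a (1 + \<epsilon>))"
      by simp
    then show "\<tau> \<in> cech_complex (1 + \<epsilon>) A"
      using y(1,2) unfolding cech_complex_def by blast
  qed
  show "cech_complex 1 A \<subseteq> cech_complex (1 + \<epsilon>) A"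
    using KM MC by blast
  show "finite ?S"
    using finite_subset [OF \<open>N \<subseteq> A\<close> \<open>finite A\<close>] by (intro finite_subset [of ?S "Pow N"]) auto
  have closed: "\<forall>\<sigma>\<in>M. \<forall>\<tau>\<subseteq>\<sigma>. \<tau> \<noteq> {} \<longrightarrow> \<tau> \<in> M"
    unfolding M_def by blast
  \<comment> \<open>The witness \<open>y\<close> of \<open>\<sigma>\<close> serves again:
    \<open>v\<close> lies outside \<open>N\<close>, hence within \<open>1\<close> of
    \<open>y\<close>, and \<open>\<phi> v\<close> is less than \<open>\<epsilon>\<close> from
    \<open>v\<close>. As a point of \<open>N\<close>, \<open>\<phi> v\<close> only has to be within
    \<open>1 + \<epsilon>\<close> of \<open>y\<close>.\<close>
  have ins: "insert (\<phi> v) \<sigma> \<in> M" if "v \<in> A - N" "\<sigma> \<in> M" "v \<in> \<sigma>" for v \<sigma>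
  proof -
    obtain y where y: "\<forall>a\<in>\<sigma>. dist a y \<le> 1 + \<epsilon> \<and> (a \<notin> N \<longrightarrow> dist a y \<le> 1)"
      using \<open>\<sigma> \<in> M\<close> by (auto simp: M_def)
    then have "dist v y \<le> 1"
      using that by blast
    then have "dist (\<phi> v) y \<le> 1 + \<epsilon>"
      using bspec [OF \<phi>, of v] that(1) dist_triangle [of "\<phi> v" y v] by (auto simp: dist_commute)
    then show ?thesis
      using y \<phi> that \<open>N \<subseteq> A\<close> by (auto simp: M_def)
  qed
  have retract: "\<forall>v\<in>A - N. \<phi> v \<notin> A - N \<and> (\<forall>\<sigma>\<in>M. v \<in> \<sigma> \<longrightarrow> insert (\<phi> v) \<sigma> \<in> M)"
    using \<phi> ins by blast
  show "\<forall>z\<in>carrier (cycle_space (cech_complex 1 A) p).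
      \<exists>y\<in>carrier (chain_space (cech_complex (1 + \<epsilon>) A) (p + 1)).
        Poly_Mapping.keys (z + boundary y) \<subseteq> ?S"
  proof
    fix z assume "z \<in> carrier (cycle_space (cech_complex 1 A) p)"
    then have z: "z \<in> carrier (cycle_space M p)"
      using carrier_chain_space_mono [OF KM] by (auto simp: carrier_cycle_space)
    obtain y where y: "y \<in> carrier (chain_space M (p + 1))"
      "\<forall>\<sigma>\<in>Poly_Mapping.keys (z + boundary y). \<sigma> \<inter> (A - N) = {}"
      using push_cycle_off_vertices [OF closed retract z finite_Diff [OF \<open>finite A\<close>]] .
    have "\<sigma> \<in> ?S" if \<sigma>: "\<sigma> \<in> Poly_Mapping.keys (z + boundary y)" for \<sigma>
    proof -
      have "\<sigma> \<in> simplices M p"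
        using cycle_add_boundary [OF closed z y(1)] \<sigma>
        by (auto simp: carrier_cycle_space carrier_chain_space)
      \<comment> \<open>A simplex of dimension \<open>p \<ge> 0\<close> is not the empty one added
        by augmentation.\<close>
      then have "\<sigma> \<in> M"
        using \<open>p \<ge> 0\<close> by (auto simp: simplices_def)
      then obtain x where x: "\<sigma> \<noteq> {}" "\<sigma> \<subseteq> A" "\<forall>a\<in>\<sigma>. dist a x \<le> 1 + \<epsilon>"
        by (auto simp: M_def)
      have "dist a b \<le> 2 * (1 + \<epsilon>)" if "a \<in> \<sigma>" "b \<in> \<sigma>" for a b
        using bspec [OF x(3) that(1)] bspec [OF x(3) that(2)] dist_triangle2 [of a b x] by simp
      moreover have "\<sigma> \<subseteq> N"
        using x(2) bspec [OF y(2) \<sigma>] by blast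
      ultimately show ?thesis
        using x(1) by simp
    qed
    moreover have "y \<in> carrier (chain_space (cech_complex (1 + \<epsilon>) A) (p + 1))"
      using y(1) carrier_chain_space_mono [OF MC] by blast
    ultimately show "\<exists>y\<in>carrier (chain_space (cech_complex (1 + \<epsilon>) A) (p + 1)).
        Poly_Mapping.keys (z + boundary y) \<subseteq> ?S"
      by blast
  qed
qed

theorem theorem4p1:
  fixes \<epsilon> :: real
  assumes "\<epsilon> > 0"
  shows "\<exists>c::real. \<forall>(A :: (real ^ 'd) set) (p::int). finite A \<longrightarrow> p \<ge> 0 \<longrightarrow>
    real (persistent_betti (cech_complex 1 A) (cech_complex (1 + \<epsilon>) A) p) \<le> c * real (card A)"
proof -
  \<comment> \<open>The packing bound at the diameter \<open>2 * (1 + \<epsilon>)\<close> is fixed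
    before \<open>A\<close> and \<open>p\<close>, so \<open>2 ^ m\<close> can serve as the
    constant.\<close>
  obtain m where m: "\<forall>(N :: (real ^ 'd) set) x. finite N \<longrightarrow>
      pairwise (\<lambda>a b. \<epsilon> \<le> dist a b) N \<longrightarrow> card (N \<inter> cball x (2 * (1 + \<epsilon>))) \<le> m"
    using separated_set_ball_card_bounded [OF assms] by (rule exE)
  have "real (persistent_betti (cech_complex 1 A) (cech_complex (1 + \<epsilon>) A) p)
      \<le> 2 ^ m * real (card A)" if A: "finite A" and p: "p \<ge> 0" for A :: "(real ^ 'd) set" and p
  proof -
    obtain N where N: "N \<subseteq> A" "pairwise (\<lambda>a b. \<epsilon> \<le> dist a b) N"
      "\<forall>a\<in>A. \<exists>b\<in>N. dist a b < \<epsilon>"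
      using separated_net_exists [OF A assms] .
    have "finite N"
      using N(1) A by (rule finite_subset)
    have "persistent_betti (cech_complex 1 A) (cech_complex (1 + \<epsilon>) A) p \<le>
        card {\<tau>. \<tau> \<noteq> {} \<and> \<tau> \<subseteq> N \<and> (\<forall>a\<in>\<tau>. \<forall>b\<in>\<tau>. dist a b \<le> 2 * (1 + \<epsilon>))}"
      by (rule persistent_betti_cech_le [OF A N(1) assms p N(3)])
    also have "\<dots> \<le> card N * 2 ^ m"
      using m \<open>finite N\<close> N(2) by (intro card_bounded_diameter_subsets_le) simp_all
    also have "\<dots> \<le> card A * 2 ^ m"
      using card_mono [OF A N(1)] by simp
    finally have "persistent_betti (cech_complex 1 A) (cech_complex (1 + \<epsilon>) A) p \<le> card A * 2 ^ m" .
    then have "real (persistent_betti (cech_complex 1 A) (cech_complex (1 + \<epsilon>) A) p)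
        \<le> real (card A * 2 ^ m)"
      by (rule of_nat_mono)
    then show ?thesis
      by (simp add: mult.commute)
  qed
  then show ?thesis
    by blast
qed

end
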